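(* Let $H$ be an infinite-dimensional separable complex Hilbert space and let $T\in\mathcal{B}(H)$ be a normal operator. Then $T\in\mathcal{M}_r(H)$ if and only if $|T|\in\mathcal{M}_r(H)$.
   Context: $\mathcal{B}(H)$ denotes the bounded linear operators on $H$; $|T|=(T^*T)^{1/2}$. For a nonzero Hilbert space $M$ and $A\in\mathcal{B}(M)$, the minimum modulus is $m(A)=\inf\{\|Ax\|: x\in M,\ \|x\|=1\}$; $A$ is minimum attaining if there is a unit vector $x_0\in M$ with $\|Ax_0\|=m(A)$. A closed subspace $M\subseteq H$ reduces $T\in\mathcal{B}(H)$ if $T(M)\subseteq M$ and $T^*(M)\subseteq M$. $\mathcal{M}_r(H)$ is the set of all $T\in\mathcal{B}(H)$ such that for every nonzero closed subspace $M$ reducing $T$, the restriction $T|_M:M\to M$ is minimum attaining. *)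

theory Defs
  imports "HOL-Analysis.Analysis"
begin

(* A complex inner product, linear in the first argument.  Building on real_inner makes the norm
   and the topology those of HOL-Analysis: norm x = sqrt (inner x x) = sqrt (Re (cinner x x)). *)
class complex_inner = real_inner +
  fixes scaleC :: "complex \<Rightarrow> 'a \<Rightarrow> 'a" (infixr \<open>*\<^sub>C\<close> 75)
    and cinner :: "'a \<Rightarrow> 'a \<Rightarrow> complex"
  assumes scaleC_add_right: "a *\<^sub>C (x + y) = a *\<^sub>C x + a *\<^sub>C y"
    and scaleC_add_left: "(a + b) *\<^sub>C x = a *\<^sub>C x + b *\<^sub>C x"
    and scaleC_scaleC: "a *\<^sub>C b *\<^sub>C x = (a * b) *\<^sub>C x"
    and scaleC_of_real: "complex_of_real r *\<^sub>C x = r *\<^sub>R x"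
    and cinner_commute: "cinner x y = cnj (cinner y x)"
    and cinner_add_left: "cinner (x + y) z = cinner x z + cinner y z"
    and cinner_scaleC_left: "cinner (a *\<^sub>C x) y = a * cinner x y"
    and inner_eq_Re_cinner: "inner x y = Re (cinner x y)"

class chilbert_space = complex_inner + complete_space

instantiation complex :: chilbert_space
begin

definition scaleC_complex :: "complex \<Rightarrow> complex \<Rightarrow> complex"
  where "scaleC_complex a x = a * x"

definition cinner_complex :: "complex \<Rightarrow> complex \<Rightarrow> complex"
  where "cinner_complex x y = x * cnj y"

instance
  by standard
    (simp_all add: scaleC_complex_def cinner_complex_def inner_complex_def algebra_simps
      scaleR_conv_of_real)

end

global_interpretation complex_vector: vector_space "scaleC :: complex \<Rightarrow> 'a \<Rightarrow> 'a::complex_inner"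
proof
  fix x :: 'a
  show "1 *\<^sub>C x = x"
    using scaleC_of_real[of 1 x] by simp
qed (simp_all add: scaleC_add_right scaleC_add_left scaleC_scaleC)

definition infinite_cdimensional :: "'a::complex_inner itself \<Rightarrow> bool"
  where "infinite_cdimensional _ \<longleftrightarrow>
    \<not> (\<exists>B :: 'a set. finite B \<and> complex_vector.span B = UNIV)"

definition bounded_clinear :: "('a::complex_inner \<Rightarrow> 'a) \<Rightarrow> bool"
  where "bounded_clinear T \<longleftrightarrow> bounded_linear T \<and> (\<forall>c x. T (c *\<^sub>C x) = c *\<^sub>C T x)"

(* On a Hilbert space, every bounded operator has exactly one adjoint. *)
definition cadjoint :: "('a::chilbert_space \<Rightarrow> 'a) \<Rightarrow> 'a \<Rightarrow> 'a"
  where "cadjoint T =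
    (THE S. bounded_clinear S \<and> (\<forall>x y. cinner (T x) y = cinner x (S y)))"

definition normal_op :: "('a::chilbert_space \<Rightarrow> 'a) \<Rightarrow> bool"
  where "normal_op T \<longleftrightarrow> bounded_clinear T \<and> cadjoint T \<circ> T = T \<circ> cadjoint T"

definition positive_op :: "('a::complex_inner \<Rightarrow> 'a) \<Rightarrow> bool"
  where "positive_op A \<longleftrightarrow> bounded_clinear A \<and> (\<forall>x. cinner (A x) x \<in> \<real>\<^sub>\<ge>\<^sub>0)"

(* On a Hilbert space, every positive operator has exactly one positive square root. *)
definition sqrt_op :: "('a::complex_inner \<Rightarrow> 'a) \<Rightarrow> 'a \<Rightarrow> 'a"
  where "sqrt_op A = (THE S. positive_op S \<and> S \<circ> S = A)"

definition abs_op :: "('a::chilbert_space \<Rightarrow> 'a) \<Rightarrow> 'a \<Rightarrow> 'a"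
  where "abs_op T = sqrt_op (cadjoint T \<circ> T)"

(* The next two notions speak about the restriction of A to a subspace M, which is meant to be
   nonzero and mapped into itself by A. *)
definition min_modulus_on :: "'a::complex_inner set \<Rightarrow> ('a \<Rightarrow> 'a) \<Rightarrow> real"
  where "min_modulus_on M A = Inf {norm (A x) | x. x \<in> M \<and> norm x = 1}"

definition min_attaining_on :: "'a::complex_inner set \<Rightarrow> ('a \<Rightarrow> 'a) \<Rightarrow> bool"
  where "min_attaining_on M A \<longleftrightarrow>
    (\<exists>x\<^sub>0\<in>M. norm x\<^sub>0 = 1 \<and> norm (A x\<^sub>0) = min_modulus_on M A)"

definition reduces :: "'a::chilbert_space set \<Rightarrow> ('a \<Rightarrow> 'a) \<Rightarrow> bool"
  where "reduces M T \<longleftrightarrow> complex_vector.subspace M \<and> closed M \<and>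
    T ` M \<subseteq> M \<and> cadjoint T ` M \<subseteq> M"

definition reducing_min_attaining :: "('a::chilbert_space \<Rightarrow> 'a) set"  (\<open>\<M>\<^sub>r\<close>)
  where "\<M>\<^sub>r = {T. bounded_clinear T \<and>
    (\<forall>M. reduces M T \<and> M \<noteq> {0} \<longrightarrow> min_attaining_on M T)}"

end

theory Submission
  imports Defs
begin

section \<open>Orthogonal projection and adjoints\<close>

text \<open>Since | |T| x | = | T x |, minimum attainment on a given subspace means the same for T
  and |T|; only the families of reducing subspaces differ. A subspace reducing T is invariant under
  T*T, hence under its square root, so it reduces |T|: this settles one direction
  (\<open>norm_abs_op\<close>, \<open>reduces_imp_reduces_abs_op\<close>).

  The converse is \<open>min_attaining_on_reducing_abs_op\<close>: |T| can have more reducing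
  subspaces (for unitary T every closed subspace reduces |T| = 1). Let M reduce |T|, with minimum
  modulus m there. If m is not attained on M, then M lies in the spectral subspace L of |T| for the
  interval from m, exclusive, to infinity. L reduces T, because T is normal and so commutes with the
  spectral projections of |T|. The minimum modulus on L is at most m as M is inside L, yet | T y | >
  m | y | for nonzero y in L, so it is not attained on L either, against the assumption on T.

  The spectral theorem is avoided: L is described through the absolute value of C = T*T - m^2. All
  that is required is a positive square root that is unique, commutes with whatever its square
  commutes with, and keeps closed invariant subspaces (\<open>positive_square_root_exists\<close>,
  \<open>square_root_unique_on\<close>).\<close>

lemma closed_subspace_decomposition:
  fixes M :: "'a::{real_inner,complete_space} set"
  assumes M: "subspace M" "closed M"
  obtains p where "p \<in> M" "\<And>w. w \<in> M \<Longrightarrow> inner (x - p) w = 0"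
proof -
  let ?S = "(\<lambda>w. (norm (x - w))\<^sup>2) ` M"
  define d where "d = Inf ?S"
  have ne: "?S \<noteq> {}"
    using subspace_0[OF M(1)] by auto
  have bdd: "bdd_below ?S"
    by (rule bdd_belowI[where m = 0]) auto
  have d_le: "d \<le> (norm (x - w))\<^sup>2" if "w \<in> M" for w
    unfolding d_def using bdd that by (intro cInf_lower) auto
  have "\<exists>w\<in>M. (norm (x - w))\<^sup>2 < d + 1 / real (Suc n)" for n
    using cInf_lessD[OF ne, of "d + 1 / real (Suc n)"] unfolding d_def by auto
  then obtain w where wM: "\<And>n. w n \<in> M"
    and w: "\<And>n. (norm (x - w n))\<^sup>2 < d + 1 / real (Suc n)"
    by metis
  have diff: "(norm (w i - w j))\<^sup>2 < 4 * (1 / real (Suc N))" if "i \<ge> N" "j \<ge> N" for i j N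
  proof -
    \<comment> \<open>Parallelogram law: the midpoint of two almost nearest points is at distance at
      least \<open>sqrt d\<close> from \<open>x\<close>, which forces the two points
      together.\<close>
    let ?c = "(1/2) *\<^sub>R (w i + w j)"
    have "?c \<in> M"
      using wM M(1) by (intro subspace_scale subspace_add)
    then have "d \<le> (norm (x - ?c))\<^sup>2"
      by (rule d_le)
    moreover have "(norm (w i - w j))\<^sup>2 + 4 * (norm (x - ?c))\<^sup>2
        = 2 * (norm (x - w i))\<^sup>2 + 2 * (norm (x - w j))\<^sup>2"
      unfolding power2_norm_eq_inner
      by (simp add: algebra_simps inner_commute)
    moreover have "1 / real (Suc i) \<le> 1 / real (Suc N)" "1 / real (Suc j) \<le> 1 / real (Suc N)"
      using that by (simp_all add: field_simps)
    ultimately show ?thesis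
      using w[of i] w[of j] by linarith
  qed
  have "Cauchy w"
  proof (rule metric_CauchyI)
    fix e :: real
    assume "0 < e"
    then obtain N where "1 / real (Suc N) < e\<^sup>2 / 4"
      using nat_approx_posE[of "e\<^sup>2 / 4"] by auto
    then have N: "4 * (1 / real (Suc N)) < e\<^sup>2"
      by linarith
    have "dist (w i) (w j) < e" if "i \<ge> N" "j \<ge> N" for i j
      using order.strict_trans[OF diff[OF that] N] \<open>0 < e\<close>
      unfolding dist_norm by (meson less_imp_le power_less_imp_less_base)
    then show "\<exists>N. \<forall>i\<ge>N. \<forall>j\<ge>N. dist (w i) (w j) < e"
      by blast
  qed
  then obtain p where p: "w \<longlonglongrightarrow> p"
    using Cauchy_convergent convergent_def by blast
  have pM: "p \<in> M"
    using wM p by (rule closed_sequentially[OF M(2)])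
  have bound: "(\<lambda>n. d + 1 / real (Suc n)) \<longlonglongrightarrow> d + 0"
    by (intro tendsto_intros LIMSEQ_Suc lim_1_over_n)
  have "(\<lambda>n. (norm (x - w n))\<^sup>2) \<longlonglongrightarrow> (norm (x - p))\<^sup>2"
    by (intro tendsto_intros p)
  then have "(norm (x - p))\<^sup>2 \<le> d + 0"
    by (rule LIMSEQ_le[OF _ bound]) (use w in \<open>blast intro: less_imp_le\<close>)
  then have p_min: "(norm (x - p))\<^sup>2 \<le> d"
    by simp
  have "inner (x - p) v = 0" if "v \<in> M" for v
  proof (cases "v = 0")
    case False
    \<comment> \<open>This \<open>t\<close> minimizes the distance from \<open>x\<close> along the
      line through \<open>p\<close> in direction \<open>v\<close>; minimality of \<open>p\<close>
      leaves no room for the gain.\<close>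
    define t where "t = inner (x - p) v / (norm v)\<^sup>2"
    have "p + t *\<^sub>R v \<in> M"
      using M(1) pM that by (intro subspace_add subspace_scale)
    then have "(norm (x - p))\<^sup>2 \<le> (norm ((x - p) - t *\<^sub>R v))\<^sup>2"
      using order.trans[OF p_min d_le] by (simp add: diff_diff_eq)
    also have "\<dots> = (norm (x - p))\<^sup>2 - 2 * t * inner (x - p) v + t\<^sup>2 * (norm v)\<^sup>2"
      unfolding power2_norm_eq_inner
      by (simp add: inner_diff inner_commute power2_eq_square)
    also have "\<dots> = (norm (x - p))\<^sup>2 - (inner (x - p) v)\<^sup>2 / (norm v)\<^sup>2"
      using False by (simp add: t_def field_simps power2_eq_square)
    finally have "(inner (x - p) v)\<^sup>2 / (norm v)\<^sup>2 \<le> 0"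
      by simp
    then show ?thesis
      using False by (simp add: divide_le_0_iff)
  qed simp
  with pM show thesis
    using that by blast
qed

text \<open>The residual \<open>u\<close> of a vector outside the kernel is orthogonal to the
  kernel, and every \<open>x\<close> is a multiple of \<open>u\<close> plus a kernel vector. The
  real version suffices, because complex linearity is recovered afterwards.\<close>

lemma Riesz_representation:
  fixes f :: "'a::{real_inner,complete_space} \<Rightarrow> real"
  assumes "bounded_linear f"
  obtains z where "\<And>x. f x = inner x z"
proof (cases "\<forall>x. f x = 0")
  case True
  then show ?thesis
    using that[of 0] by simp
next
  case False
  then obtain a where a: "f a \<noteq> 0"
    by blast
  interpret f: bounded_linear f
    by (rule assms)
  let ?K = "{x. f x = 0}"
  have "subspace ?K"
    by (auto simp: subspace_def f.zero f.add f.scaleR)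
  moreover have "closed ?K"
    by (intro closed_Collect_eq continuous_intros f.continuous_on)
  ultimately obtain p where p: "p \<in> ?K" "\<And>w. w \<in> ?K \<Longrightarrow> inner (a - p) w = 0"
    by (rule closed_subspace_decomposition[where x = a]) blast
  define u where "u = a - p"
  have fu: "f u \<noteq> 0"
    using a p(1) by (simp add: u_def f.diff)
  then have u: "u \<noteq> 0"
    using f.zero by blast
  have "f x = inner x ((f u / inner u u) *\<^sub>R u)" for x
  proof -
    have "f (x - (f x / f u) *\<^sub>R u) = 0"
      using fu by (simp add: f.diff f.scaleR)
    then have "inner u (x - (f x / f u) *\<^sub>R u) = 0"
      using p(2) by (simp add: u_def)
    then show ?thesis
      using fu u by (simp add: inner_diff inner_commute field_simps)
  qed
  then show ?thesis
    by (rule that)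
qed

section \<open>Complex inner product in terms of the real one, and adjoints\<close>

lemma cinner_add_right: "cinner x (y + z) = cinner x y + cinner x z"
  by (metis cinner_add_left cinner_commute complex_cnj_add)

lemma cinner_scaleC_right: "cinner x (c *\<^sub>C y) = cnj c * cinner x y"
  by (metis cinner_commute cinner_scaleC_left complex_cnj_mult)

lemma cinner_conv_inner: "cinner x y = Complex (inner x y) (inner x (\<i> *\<^sub>C y))"
  by (rule complex_eqI) (simp_all add: inner_eq_Re_cinner cinner_scaleC_right)

lemma inner_scaleC_left: "inner (c *\<^sub>C x) y = inner x (cnj c *\<^sub>C y)"
  by (simp add: inner_eq_Re_cinner cinner_scaleC_right cinner_scaleC_left)

lemma norm_scaleC: "norm (c *\<^sub>C x) = cmod c * norm (x::'a::complex_inner)"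
proof -
  have "inner (c *\<^sub>C x) (c *\<^sub>C x) = (cmod c)\<^sup>2 * inner x x"
    unfolding inner_scaleC_left scaleC_scaleC
    by (metis complex_norm_square inner_scaleR_right mult.commute scaleC_of_real)
  then show ?thesis
    by (simp add: norm_eq_sqrt_inner real_sqrt_mult)
qed

lemma bounded_linear_scaleC: "bounded_linear (\<lambda>x::'a::complex_inner. c *\<^sub>C x)"
proof (rule bounded_linear_intro[where K = "cmod c"])
  show "c *\<^sub>C r *\<^sub>R x = r *\<^sub>R c *\<^sub>C x" for r and x :: 'a
    by (simp flip: scaleC_of_real add: scaleC_scaleC mult.commute)
qed (simp_all add: scaleC_add_right norm_scaleC)

lemma csubspace_imp_subspace: "complex_vector.subspace M \<Longrightarrow> subspace M"
  unfolding subspace_def complex_vector.subspace_def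
  by (metis scaleC_of_real)

lemma inner_eqI:
  fixes y z :: "'a::real_inner"
  assumes "\<And>x. inner x y = inner x z"
  shows "y = z"
proof -
  have "inner (y - z) (y - z) = 0"
    using assms[of "y - z"] by (simp add: inner_diff_right)
  then show ?thesis
    by simp
qed

text \<open>The imaginary part of \<open>cinner\<close> is the real inner product with
  \<open>\<i> *\<^sub>C y\<close>, so complex homogeneity lifts a real adjoint relation to the
  complex one.\<close>

lemma cinner_adjointI:
  assumes "\<And>c x. T (c *\<^sub>C x) = c *\<^sub>C T x" and "\<And>c x. S (c *\<^sub>C x) = c *\<^sub>C S x"
    and "\<And>x y. inner (T x) y = inner x (S y)"
  shows "cinner (T x) y = cinner x (S y)"
  unfolding cinner_conv_inner by (simp add: assms(3) assms(2)[symmetric])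

text \<open>Riesz representation of the functional sending \<open>x\<close> to
  \<open>inner (T x) y\<close> yields \<open>S y\<close>. Linearity follows from nondegeneracy, the
  bound from | S x |^2 = \<open>inner (T (S x)) x\<close>.\<close>

lemma adjoint_exists:
  fixes T :: "'a::chilbert_space \<Rightarrow> 'a"
  assumes "bounded_clinear T"
  shows "\<exists>S. bounded_clinear S \<and> (\<forall>x y. cinner (T x) y = cinner x (S y))"
proof -
  have T: "bounded_linear T" "\<And>c x. T (c *\<^sub>C x) = c *\<^sub>C T x"
    using assms by (auto simp: bounded_clinear_def)
  have "\<exists>z. \<forall>x. inner (T x) y = inner x z" for y
    using Riesz_representation[OF bounded_linear_compose[OF bounded_linear_inner_left T(1)], of y]
    by blast
  then obtain S where S: "\<And>x y. inner (T x) y = inner x (S y)"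
    by metis
  obtain K where K: "\<And>x. norm (T x) \<le> norm x * K" "0 < K"
    using bounded_linear.pos_bounded[OF T(1)] by blast
  have scaleC: "S (c *\<^sub>C x) = c *\<^sub>C S x" for c x
  proof (rule inner_eqI)
    fix z
    have "inner z (S (c *\<^sub>C x)) = inner (cnj c *\<^sub>C T z) x"
      by (simp add: inner_scaleC_left flip: S)
    also have "\<dots> = inner z (c *\<^sub>C S x)"
      by (simp add: inner_scaleC_left S flip: T(2))
    finally show "inner z (S (c *\<^sub>C x)) = inner z (c *\<^sub>C S x)" .
  qed
  have "bounded_linear S"
  proof (rule bounded_linear_intro[where K = K])
    show "S (x + y) = S x + S y" for x y
      by (rule inner_eqI) (simp flip: S add: inner_add_right)
    show "S (r *\<^sub>R x) = r *\<^sub>R S x" for r x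
      by (rule inner_eqI) (simp flip: S)
    show "norm (S x) \<le> norm x * K" for x
    proof -
      have "norm (S x) * norm (S x) = inner (T (S x)) x"
        by (simp add: S power2_norm_eq_inner[symmetric] power2_eq_square)
      also have "\<dots> \<le> norm (T (S x)) * norm x"
        by (rule norm_cauchy_schwarz)
      also have "\<dots> \<le> norm (S x) * K * norm x"
        using K(1) by (intro mult_right_mono) auto
      finally show ?thesis
        using K(2) by (cases "norm (S x) = 0") (auto simp: mult_ac)
    qed
  qed
  with scaleC have "bounded_clinear S"
    by (simp add: bounded_clinear_def)
  with cinner_adjointI[OF T(2) scaleC S] show ?thesis
    by blast
qed

lemma cinner_eqI:
  assumes "\<And>x. cinner x y = cinner x z"
  shows "y = z"
  by (rule inner_eqI) (simp add: inner_eq_Re_cinner assms)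

lemma cadjoint_equality:
  assumes "bounded_clinear S" and "\<And>x y. cinner (T x) y = cinner x (S y)"
  shows "cadjoint T = S"
  unfolding cadjoint_def
proof (rule the_equality)
  show "S' = S" if "bounded_clinear S' \<and> (\<forall>x y. cinner (T x) y = cinner x (S' y))" for S'
    by (rule ext, rule cinner_eqI) (simp flip: that[THEN conjunct2, rule_format] assms(2))
qed (use assms in blast)

lemma
  assumes "bounded_clinear T"
  shows bounded_clinear_cadjoint: "bounded_clinear (cadjoint T)"
    and cinner_cadjoint: "cinner (T x) y = cinner x (cadjoint T y)"
proof -
  obtain S where S: "bounded_clinear S" "\<And>x y. cinner (T x) y = cinner x (S y)"
    using adjoint_exists[OF assms] by blast
  then have "cadjoint T = S"
    by (rule cadjoint_equality)
  with S show "bounded_clinear (cadjoint T)" "cinner (T x) y = cinner x (cadjoint T y)"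
    by simp_all
qed

lemma inner_cadjoint: "bounded_clinear T \<Longrightarrow> inner (T x) y = inner x (cadjoint T y)"
  by (simp add: inner_eq_Re_cinner cinner_cadjoint)

section \<open>The positive square root\<close>

text \<open>Polarization: the quadratic form is real at \<open>x\<close>, \<open>y\<close> and \<open>x + \<i> y\<close>.\<close>

lemma positive_op_selfadjoint:
  assumes "positive_op A"
  shows "inner (A x) y = inner x (A y)"
proof -
  have im: "Im (cinner (A z) z) = 0" for z
    using assms by (auto simp: positive_op_def complex_nonneg_Reals_iff)
  interpret A: bounded_linear A
    using assms by (auto simp: positive_op_def bounded_clinear_def)
  have A: "A (c *\<^sub>C z) = c *\<^sub>C A z" for c z
    using assms by (auto simp: positive_op_def bounded_clinear_def)
  have "Im (cinner (A (x + \<i> *\<^sub>C y)) (x + \<i> *\<^sub>C y)) = 0"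
    by (rule im)
  then have "Re (cinner (A x) y) = Re (cinner (A y) x)"
    using im[of x] im[of y]
    by (simp add: A.add A cinner_add_left cinner_add_right cinner_scaleC_left cinner_scaleC_right)
  then show ?thesis
    by (simp add: inner_eq_Re_cinner[symmetric] inner_commute)
qed

lemma positive_op_inner: "positive_op A \<Longrightarrow> 0 \<le> inner (A x) x"
  by (auto simp: positive_op_def complex_nonneg_Reals_iff inner_eq_Re_cinner)

lemma positive_opI:
  assumes A: "bounded_clinear A" "\<And>x y. inner (A x) y = inner x (A y)"
    and "\<And>x. 0 \<le> inner (A x) x"
  shows "positive_op A"
proof -
  have "cinner (A x) x = cinner x (A x)" for x
    using A by (intro cinner_adjointI) (auto simp: bounded_clinear_def)
  then have "Im (cinner (A x) x) = 0" for x
    by (metis cinner_commute Reals_cnj_iff complex_is_Real_iff)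
  then show ?thesis
    using assms by (auto simp: positive_op_def complex_nonneg_Reals_iff inner_eq_Re_cinner)
qed

text \<open>Nonnegativity of the quadratic form of \<open>A\<close> at \<open>x - K\<^sup>-\<^sup>1 A x\<close>.\<close>

lemma positive_norm_le:
  fixes A :: "'a::real_inner \<Rightarrow> 'a"
  assumes "linear A" and sa: "\<And>x y. inner (A x) y = inner x (A y)"
    and pos: "\<And>x. 0 \<le> inner (A x) x"
    and K: "0 < K" "\<And>x. norm (A x) \<le> norm x * K"
  shows "(norm (A x))\<^sup>2 \<le> K * inner (A x) x"
proof -
  interpret A: linear A
    by (rule assms)
  have "inner (A (A x)) (A x) \<le> norm (A (A x)) * norm (A x)"
    by (rule norm_cauchy_schwarz)
  also have "\<dots> \<le> K * (norm (A x))\<^sup>2"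
    using mult_right_mono[OF K(2)[of "A x"], of "norm (A x)"]
    by (simp add: power2_eq_square mult_ac)
  finally have *: "inner (A (A x)) (A x) \<le> K * (norm (A x))\<^sup>2" .
  have "0 \<le> inner (A (x - (1/K) *\<^sub>R A x)) (x - (1/K) *\<^sub>R A x)"
    by (rule pos)
  also have "\<dots> = inner (A x) x - 2 / K * (norm (A x))\<^sup>2 + inner (A (A x)) (A x) / K\<^sup>2"
    unfolding power2_norm_eq_inner
    by (simp add: A.diff A.scaleR inner_diff sa power2_eq_square diff_divide_distrib)
  also have "\<dots> \<le> inner (A x) x - 2 / K * (norm (A x))\<^sup>2 + K * (norm (A x))\<^sup>2 / K\<^sup>2"
    using * by (intro add_left_mono divide_right_mono) auto
  also have "\<dots> = inner (A x) x - (norm (A x))\<^sup>2 / K"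
    using K(1) by (simp add: field_simps power2_eq_square)
  finally show ?thesis
    using K(1) by (simp add: field_simps)
qed

text \<open>Stronger than boundedness: it makes \<open>A x\<close> vanish wherever the quadratic
  form does, and makes 1 - A/K a contraction.\<close>

lemma positive_op_bound:
  assumes "positive_op A"
  obtains K where "0 < K" "\<And>x. (norm (A x))\<^sup>2 \<le> K * inner (A x) x"
proof -
  have A: "bounded_linear A"
    using assms by (auto simp: positive_op_def bounded_clinear_def)
  obtain K where K: "\<And>x. norm (A x) \<le> norm x * K" "0 < K"
    using bounded_linear.pos_bounded[OF A] by blast
  show thesis
    using that[OF K(2)] positive_norm_le[OF bounded_linear.linear[OF A], of K] K
      positive_op_selfadjoint[OF assms] positive_op_inner[OF assms] by blast
qed

lemma positive_op_eq_0:
  assumes "positive_op A" "inner (A x) x = 0"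
  shows "A x = 0"
proof -
  obtain K where "(norm (A x))\<^sup>2 \<le> K * inner (A x) x"
    using positive_op_bound[OF assms(1)] by blast
  then show ?thesis
    by (simp add: assms(2))
qed

text \<open>The vector y = R x - C x satisfies (R + C) y = 0. Both forms are nonnegative at y, so R
  y = C y = 0, and | y |^2 = \<open>inner x (R y - C y)\<close> = 0. Asking positivity of
  \<open>C\<close> only on \<open>M\<close> covers both uniqueness of the root
  (\<open>M = UNIV\<close>) and |C| = C on a subspace where C is positive.\<close>

lemma square_root_unique_on:
  assumes R: "positive_op R"
    and C: "linear C" "\<And>x y. inner (C x) y = inner x (C y)"
    and comm: "\<And>x. R (C x) = C (R x)" and sq: "\<And>x. R (R x) = C (C x)"
    and M: "subspace M" "R ` M \<subseteq> M" "C ` M \<subseteq> M"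
    and pos: "\<And>x. x \<in> M \<Longrightarrow> 0 \<le> inner (C x) x" and x: "x \<in> M"
  shows "R x = C x"
proof -
  interpret R: bounded_linear R
    using R by (auto simp: positive_op_def bounded_clinear_def)
  interpret C: linear C
    by (rule C)
  define y where "y = R x - C x"
  have yM: "y \<in> M"
    using M x unfolding y_def by (blast intro: subspace_diff)
  have sum0: "R y + C y = 0"
    by (simp add: y_def R.diff C.diff comm sq)
  then have "inner (R y) y + inner (C y) y = 0"
    by (metis inner_add_left inner_zero_left)
  then have "inner (R y) y = 0"
    using positive_op_inner[OF R, of y] pos[OF yM] by linarith
  then have "R y = 0"
    by (rule positive_op_eq_0[OF R])
  with sum0 have "R y - C y = 0"
    by simp
  moreover have "inner y y = inner x (R y - C y)"
    unfolding y_def by (simp add: inner_diff C(2) positive_op_selfadjoint[OF R] R.diff C.diff)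
  ultimately show ?thesis
    by (simp add: y_def)
qed


section \<open>Iteration for the square root of a positive operator\<close>

text \<open>The limit \<open>Y\<close> of the iteration satisfies \<open>Y = (X + Y\<^sup>2) / 2\<close>, that is, \<open>(1 - Y)\<^sup>2 = 1 - X\<close>.\<close>

primrec sqrt_iter :: "('a::real_vector \<Rightarrow> 'a) \<Rightarrow> nat \<Rightarrow> 'a \<Rightarrow> 'a"
  where
    "sqrt_iter X 0 x = 0"
  | "sqrt_iter X (Suc n) x = (1/2) *\<^sub>R (X x + sqrt_iter X n (sqrt_iter X n x))"

primrec sqrt_majorant :: "nat \<Rightarrow> real"
  where
    "sqrt_majorant 0 = 0"
  | "sqrt_majorant (Suc n) = (1 + (sqrt_majorant n)\<^sup>2) / 2"

lemma sqrt_majorant_nonneg: "0 \<le> sqrt_majorant n"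
  by (induction n) auto

lemma sqrt_majorant_le_1: "sqrt_majorant n \<le> 1"
proof (induction n)
  case (Suc n)
  then have "(sqrt_majorant n)\<^sup>2 \<le> 1"
    by (simp add: power_le_one sqrt_majorant_nonneg)
  then show ?case
    by simp
qed simp

lemma sqrt_majorant_Suc_ge: "sqrt_majorant n \<le> sqrt_majorant (Suc n)"
  \<comment> \<open>The increment is half of this square.\<close>
  using zero_le_power2[of "1 - sqrt_majorant n"] by (simp add: power2_eq_square algebra_simps)

lemma Cauchy_sqrt_majorant: "Cauchy sqrt_majorant"
proof -
  have "incseq sqrt_majorant"
    by (rule incseq_SucI) (rule sqrt_majorant_Suc_ge)
  then have "convergent sqrt_majorant"
    using sqrt_majorant_le_1 incseq_convergent convergentI by metis
  then show ?thesis
    by (rule convergent_Cauchy)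
qed

context
  fixes X :: "'a::{real_inner,complete_space} \<Rightarrow> 'a"
  assumes X: "bounded_linear X" and contraction: "\<And>x. norm (X x) \<le> norm x"
begin

lemma bounded_linear_sqrt_iter: "bounded_linear (sqrt_iter X n)"
proof (induction n)
  case 0
  show ?case
    by (simp add: bounded_linear_zero fun_eq_iff[of "sqrt_iter X 0"])
next
  case (Suc n)
  show ?case
    unfolding sqrt_iter.simps
    by (intro bounded_linear_const_scaleR bounded_linear_add X bounded_linear_compose[OF Suc Suc])
qed

text \<open>Each iterate is a polynomial in \<open>X\<close>.\<close>

lemma sqrt_iter_commute:
  assumes "linear D" "\<And>x. D (X x) = X (D x)"
  shows "D (sqrt_iter X n x) = sqrt_iter X n (D x)"
  by (induction n arbitrary: x)
    (simp_all add: assms linear_0 linear_add linear_scale)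

lemma sqrt_iter_commute_sqrt_iter:
  "sqrt_iter X m (sqrt_iter X n x) = sqrt_iter X n (sqrt_iter X m x)"
  by (intro sqrt_iter_commute sqrt_iter_commute[symmetric] bounded_linear.linear
      bounded_linear_sqrt_iter X refl)

lemma norm_sqrt_iter: "norm (sqrt_iter X n x) \<le> sqrt_majorant n * norm x"
proof (induction n arbitrary: x)
  case (Suc n)
  have "norm (sqrt_iter X n (sqrt_iter X n x)) \<le> sqrt_majorant n * norm (sqrt_iter X n x)"
    by (rule Suc)
  also have "\<dots> \<le> sqrt_majorant n * (sqrt_majorant n * norm x)"
    by (intro mult_left_mono Suc sqrt_majorant_nonneg)
  finally have "norm (X x + sqrt_iter X n (sqrt_iter X n x))
      \<le> norm x + (sqrt_majorant n)\<^sup>2 * norm x"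
    by (intro norm_triangle_le add_mono contraction) (simp add: power2_eq_square)
  then show ?case
    by (simp add: distrib_right del: scaleR_add_right)
qed simp

text \<open>Since the iterates commute, \<open>Y\<^sup>2 - Z\<^sup>2 = (Y - Z)(Y + Z)\<close>, so that the increments are dominated
  by those of the scalar iteration, which is the case \<open>X = 1\<close>.\<close>

lemma norm_sqrt_iter_Suc_diff:
  "norm (sqrt_iter X (Suc n) x - sqrt_iter X n x)
    \<le> (sqrt_majorant (Suc n) - sqrt_majorant n) * norm x"
proof (induction n arbitrary: x)
  case 0
  show ?case
    using contraction[of x] by simp
next
  case (Suc n)
  define Y where "Y = sqrt_iter X (Suc n)"
  define Z where "Z = sqrt_iter X n"
  define y where "y = sqrt_majorant (Suc n)"
  define z where "z = sqrt_majorant n"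
  interpret Y: bounded_linear Y
    unfolding Y_def by (rule bounded_linear_sqrt_iter)
  interpret Z: bounded_linear Z
    unfolding Z_def by (rule bounded_linear_sqrt_iter)
  have comm: "Y (Z u) = Z (Y u)" for u
    unfolding Y_def Z_def by (rule sqrt_iter_commute_sqrt_iter)
  have "sqrt_iter X (Suc (Suc n)) x - sqrt_iter X (Suc n) x
      = (1/2) *\<^sub>R (X x + Y (Y x)) - (1/2) *\<^sub>R (X x + Z (Z x))"
    unfolding Y_def Z_def sqrt_iter.simps ..
  also have "\<dots> = (1/2) *\<^sub>R (Y (Y x + Z x) - Z (Y x + Z x))"
    by (simp add: Y.add Z.add comm algebra_simps)
  finally have "norm (sqrt_iter X (Suc (Suc n)) x - sqrt_iter X (Suc n) x)
      = norm (Y (Y x + Z x) - Z (Y x + Z x)) / 2"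
    by simp
  also have "\<dots> \<le> (y - z) * norm (Y x + Z x) / 2"
    unfolding Y_def Z_def y_def z_def by (intro divide_right_mono Suc) simp
  also have "\<dots> \<le> (y - z) * ((y + z) * norm x) / 2"
  proof -
    have "norm (Y x + Z x) \<le> y * norm x + z * norm x"
      unfolding Y_def Z_def y_def z_def by (intro norm_triangle_le add_mono norm_sqrt_iter)
    moreover have "0 \<le> y - z"
      using sqrt_majorant_Suc_ge by (simp add: y_def z_def)
    ultimately show ?thesis
      by (intro divide_right_mono mult_left_mono) (auto simp: distrib_right)
  qed
  also have "\<dots> = ((1 + y\<^sup>2) / 2 - (1 + z\<^sup>2) / 2) * norm x"
    by (simp add: power2_eq_square field_simps)
  also have "\<dots> = (sqrt_majorant (Suc (Suc n)) - sqrt_majorant (Suc n)) * norm x"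
    by (simp add: y_def z_def)
  finally show ?case .
qed

lemma norm_sqrt_iter_diff:
  assumes "m \<le> n"
  shows "norm (sqrt_iter X n x - sqrt_iter X m x)
    \<le> (sqrt_majorant n - sqrt_majorant m) * norm x"
  using assms
proof (induction rule: dec_induct)
  case (step n)
  have "norm (sqrt_iter X (Suc n) x - sqrt_iter X m x)
    \<le> norm (sqrt_iter X (Suc n) x - sqrt_iter X n x) + norm (sqrt_iter X n x - sqrt_iter X m x)"
    using norm_triangle_ineq[of "sqrt_iter X (Suc n) x - sqrt_iter X n x"
        "sqrt_iter X n x - sqrt_iter X m x"] by (simp del: sqrt_iter.simps)
  also have "\<dots> \<le> (sqrt_majorant (Suc n) - sqrt_majorant n) * norm x
      + (sqrt_majorant n - sqrt_majorant m) * norm x"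
    by (intro add_mono step.IH norm_sqrt_iter_Suc_diff)
  finally show ?case
    by (simp only: distrib_right[symmetric]) simp
qed simp

lemma convergent_sqrt_iter: "convergent (\<lambda>n. sqrt_iter X n x)"
proof -
  have "Cauchy (\<lambda>n. sqrt_iter X n x)"
  proof (rule CauchyI')
    fix e :: real
    assume "0 < e"
    \<comment> \<open>The added 1 covers \<open>x = 0\<close>.\<close>
    then have "0 < e / (norm x + 1)"
      by (simp add: add_nonneg_pos)
    then obtain N where N: "\<And>m n. m \<ge> N \<Longrightarrow> n \<ge> N \<Longrightarrow>
        \<bar>sqrt_majorant m - sqrt_majorant n\<bar> < e / (norm x + 1)"
      using Cauchy_sqrt_majorant unfolding Cauchy_def dist_real_def by metis
    have "dist (sqrt_iter X m x) (sqrt_iter X n x) < e" if "N \<le> m" "m < n" for m n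
    proof -
      have "dist (sqrt_iter X m x) (sqrt_iter X n x)
          \<le> (sqrt_majorant n - sqrt_majorant m) * norm x"
        using norm_sqrt_iter_diff[of m n x] that by (simp add: dist_norm norm_minus_commute)
      also have "\<dots> \<le> e / (norm x + 1) * norm x"
        using N[of n m] that by (intro mult_right_mono) auto
      also have "\<dots> < e"
        using \<open>0 < e\<close> by (simp add: pos_divide_less_eq add_pos_nonneg add_nonneg_pos distrib_left)
      finally show ?thesis .
    qed
    then show "\<exists>N. \<forall>m\<ge>N. \<forall>n>m. dist (sqrt_iter X m x) (sqrt_iter X n x) < e"
      by blast
  qed
  then show ?thesis
    by (rule Cauchy_convergent)
qed

definition sqrt_limit :: "'a \<Rightarrow> 'a"
  where "sqrt_limit x = lim (\<lambda>n. sqrt_iter X n x)"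

lemma sqrt_iter_tendsto: "(\<lambda>n. sqrt_iter X n x) \<longlonglongrightarrow> sqrt_limit x"
  unfolding sqrt_limit_def using convergent_sqrt_iter by (simp add: convergent_LIMSEQ_iff)

lemma norm_sqrt_iter_le: "norm (sqrt_iter X n x) \<le> norm x"
  using order.trans[OF norm_sqrt_iter mult_right_mono[OF sqrt_majorant_le_1 norm_ge_zero]]
  by simp

lemma norm_sqrt_limit: "norm (sqrt_limit x) \<le> norm x"
  using tendsto_norm[OF sqrt_iter_tendsto] by (rule Lim_bounded) (use norm_sqrt_iter_le in blast)

lemma bounded_linear_sqrt_limit: "bounded_linear sqrt_limit"
proof (rule bounded_linear_intro[where K = 1])
  show "sqrt_limit (x + y) = sqrt_limit x + sqrt_limit y" for x y
    using sqrt_iter_tendsto[of "x + y"]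
      tendsto_add[OF sqrt_iter_tendsto[of x] sqrt_iter_tendsto[of y]]
    by (simp add: LIMSEQ_unique linear_add[OF bounded_linear.linear[OF bounded_linear_sqrt_iter]])
  show "sqrt_limit (r *\<^sub>R x) = r *\<^sub>R sqrt_limit x" for r x
    using sqrt_iter_tendsto[of "r *\<^sub>R x"]
      tendsto_scaleR[OF tendsto_const[of r] sqrt_iter_tendsto[of x]]
    by (simp add: LIMSEQ_unique linear_scale[OF bounded_linear.linear[OF bounded_linear_sqrt_iter]])
qed (use norm_sqrt_limit in simp)

lemma sqrt_limit_fixpoint: "sqrt_limit x = (1/2) *\<^sub>R (X x + sqrt_limit (sqrt_limit x))"
proof -
  let ?Y = "sqrt_iter X" and ?L = sqrt_limit
  \<comment> \<open>The square converges by splitting \<open>?Y n (?Y n x)\<close> into this term,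
    null because the iterates are contractions, and \<open>?Y n (?L x)\<close>.\<close>
  have "(\<lambda>n. ?Y n (?Y n x - ?L x)) \<longlonglongrightarrow> 0"
  proof (rule Lim_null_comparison)
    show "(\<lambda>n. norm (?Y n x - ?L x)) \<longlonglongrightarrow> 0"
      using sqrt_iter_tendsto[of x] by (simp add: LIM_zero tendsto_norm_zero)
  qed (simp add: norm_sqrt_iter_le)
  from tendsto_add[OF this sqrt_iter_tendsto[of "?L x"]]
  have "(\<lambda>n. ?Y n (?Y n x)) \<longlonglongrightarrow> ?L (?L x)"
    by (simp add: linear_diff[OF bounded_linear.linear[OF bounded_linear_sqrt_iter]])
  then have "(\<lambda>n. ?Y (Suc n) x) \<longlonglongrightarrow> (1/2) *\<^sub>R (X x + ?L (?L x))"
    unfolding sqrt_iter.simps by (intro tendsto_intros)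
  then show ?thesis
    using LIMSEQ_Suc[OF sqrt_iter_tendsto[of x]] LIMSEQ_unique by blast
qed

lemma sqrt_limit_selfadjoint:
  assumes "\<And>x y. inner (X x) y = inner x (X y)"
  shows "inner (sqrt_limit x) y = inner x (sqrt_limit y)"
proof -
  have "inner (sqrt_iter X n x) y = inner x (sqrt_iter X n y)" for n x y
    by (induction n arbitrary: x y) (simp_all add: assms inner_add)
  then have "(\<lambda>n. inner (sqrt_iter X n x) y) = (\<lambda>n. inner x (sqrt_iter X n y))"
    by blast
  moreover have "(\<lambda>n. inner (sqrt_iter X n x) y) \<longlonglongrightarrow> inner (sqrt_limit x) y"
    "(\<lambda>n. inner x (sqrt_iter X n y)) \<longlonglongrightarrow> inner x (sqrt_limit y)"
    by (intro tendsto_intros sqrt_iter_tendsto)+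
  ultimately show ?thesis
    using LIMSEQ_unique by metis
qed

lemma sqrt_limit_commute:
  assumes "bounded_linear D" "\<And>x. D (X x) = X (D x)"
  shows "D (sqrt_limit x) = sqrt_limit (D x)"
proof -
  have "(\<lambda>n. D (sqrt_iter X n x)) \<longlonglongrightarrow> D (sqrt_limit x)"
    by (rule bounded_linear.tendsto[OF assms(1) sqrt_iter_tendsto])
  moreover have "D (sqrt_iter X n x) = sqrt_iter X n (D x)" for n
    using assms by (intro sqrt_iter_commute bounded_linear.linear)
  ultimately show ?thesis
    using sqrt_iter_tendsto[of "D x"] LIMSEQ_unique by simp
qed

lemma sqrt_limit_invariant:
  assumes "subspace M" "closed M" "X ` M \<subseteq> M" "x \<in> M"
  shows "sqrt_limit x \<in> M"
proof -
  have "sqrt_iter X n x \<in> M" if "x \<in> M" for n x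
    using that
  proof (induction n arbitrary: x)
    case (Suc n)
    then show ?case
      using assms(1,3) by (auto intro!: subspace_scale subspace_add)
  qed (simp add: subspace_0[OF assms(1)])
  from this[OF assms(4)] show ?thesis
    by (rule closed_sequentially[OF assms(2) _ sqrt_iter_tendsto])
qed

end

text \<open>With X = 1 - A/K, a contraction, the limit Y satisfies (1 - Y)^2 = A/K, so S = sqrt K (1
  - Y). Commutation and invariance pass from X to the iterates and on to the limit.\<close>

lemma positive_square_root_exists:
  fixes A :: "'a::chilbert_space \<Rightarrow> 'a"
  assumes A: "positive_op A"
  shows "\<exists>S. positive_op S \<and> S \<circ> S = A
    \<and> (\<forall>D. bounded_linear D \<longrightarrow> (\<forall>x. D (A x) = A (D x)) \<longrightarrow> (\<forall>x. D (S x) = S (D x)))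
    \<and> (\<forall>M. subspace M \<longrightarrow> closed M \<longrightarrow> A ` M \<subseteq> M \<longrightarrow> S ` M \<subseteq> M)"
proof -
  obtain K where K: "0 < K" "\<And>x. (norm (A x))\<^sup>2 \<le> K * inner (A x) x"
    using positive_op_bound[OF A] by blast
  have blA: "bounded_linear A" and scaleC_A: "\<And>c x. A (c *\<^sub>C x) = c *\<^sub>C A x"
    using A by (auto simp: positive_op_def bounded_clinear_def)
  note saA = positive_op_selfadjoint[OF A]
  define X where "X x = x - (1/K) *\<^sub>R A x" for x
  have X: "bounded_linear X"
    unfolding X_def
    by (intro bounded_linear_sub bounded_linear_ident bounded_linear_const_scaleR blA)
  have contr: "norm (X x) \<le> norm x" for x
  proof -
    have "(norm (X x))\<^sup>2 = (norm x)\<^sup>2 - 2 / K * inner (A x) x + (norm (A x))\<^sup>2 / K\<^sup>2"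
      unfolding power2_norm_eq_inner X_def
      by (simp add: inner_diff inner_commute power2_eq_square)
    also have "\<dots> \<le> (norm x)\<^sup>2 - 2 / K * inner (A x) x + K * inner (A x) x / K\<^sup>2"
      by (intro add_left_mono divide_right_mono K) simp
    also have "\<dots> = (norm x)\<^sup>2 - inner (A x) x / K"
      using K(1) by (simp add: power2_eq_square field_simps)
    also have "\<dots> \<le> (norm x)\<^sup>2"
      using positive_op_inner[OF A, of x] K(1) by simp
    finally show ?thesis
      by (simp add: power2_le_iff_abs_le)
  qed
  have saX: "inner (X x) y = inner x (X y)" for x y
    by (simp add: X_def inner_diff saA)
  let ?L = "sqrt_limit X"
  interpret L: bounded_linear ?L
    by (rule bounded_linear_sqrt_limit[OF X contr])
  define S where "S x = sqrt K *\<^sub>R (x - ?L x)" for x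
  have comm: "D (S x) = S (D x)"
    if D: "bounded_linear D" "\<forall>x. D (A x) = A (D x)" for D x
  proof -
    interpret D: bounded_linear D
      by (rule D)
    have "D (X x) = X (D x)" for x
      by (simp add: X_def D.diff D.scaleR D(2))
    from sqrt_limit_commute[OF X contr D(1) this] show ?thesis
      by (simp add: S_def D.diff D.scaleR)
  qed
  have "positive_op S"
  proof (rule positive_opI)
    have "bounded_linear S"
      unfolding S_def
      by (intro bounded_linear_const_scaleR bounded_linear_sub bounded_linear_ident
          L.bounded_linear_axioms)
    \<comment> \<open>\<open>D\<close> need only be real linear, so complex scalar multiplication is
      an admissible \<open>D\<close>.\<close>
    moreover have "S (c *\<^sub>C x) = c *\<^sub>C S x" for c x
      using comm[OF bounded_linear_scaleC] by (simp add: scaleC_A)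
    ultimately show "bounded_clinear S"
      by (simp add: bounded_clinear_def)
    show "inner (S x) y = inner x (S y)" for x y
      by (simp add: S_def inner_diff sqrt_limit_selfadjoint[OF X contr saX])
    show "0 \<le> inner (S x) x" for x
    proof -
      have "inner (?L x) x \<le> norm (?L x) * norm x"
        by (rule norm_cauchy_schwarz)
      also have "\<dots> \<le> norm x * norm x"
        by (intro mult_right_mono norm_sqrt_limit[OF X contr]) simp
      finally show ?thesis
        using K(1) by (simp add: S_def inner_diff power2_norm_eq_inner[symmetric] power2_eq_square)
    qed
  qed
  moreover have "S (S x) = A x" for x
  proof -
    have LL: "?L (?L x) = 2 *\<^sub>R ?L x - X x"
      using arg_cong[OF sqrt_limit_fixpoint[OF X contr, of x], of "\<lambda>u. 2 *\<^sub>R u"] by simp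
    have "S (S x) = K *\<^sub>R (x - ?L x - (?L x - ?L (?L x)))"
      using K(1) by (simp add: S_def L.diff L.scaleR flip: scaleR_diff_right)
    also have "x - ?L x - (?L x - ?L (?L x)) = x - X x"
      by (simp add: LL scaleR_2)
    also have "K *\<^sub>R (x - X x) = A x"
      using K(1) by (simp add: X_def)
    finally show ?thesis .
  qed
  moreover have "S ` M \<subseteq> M" if M: "subspace M" "closed M" "A ` M \<subseteq> M" for M
  proof -
    have "X ` M \<subseteq> M"
      using M(1,3) unfolding X_def by (auto intro!: subspace_diff subspace_scale)
    with sqrt_limit_invariant[OF X contr M(1,2)] M(1) show ?thesis
      unfolding S_def by (auto intro!: subspace_diff subspace_scale)
  qed
  ultimately show ?thesis
    using comm by (intro exI[of _ S] conjI ext) auto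
qed

text \<open>Any other positive root \<open>R\<close> commutes with \<open>A\<close>, which is
  \<open>R \<circ> R\<close>, hence with \<open>S\<close>; then \<open>square_root_unique_on\<close>
  applies on the whole space.\<close>

lemma sqrt_op_equality:
  fixes A :: "'a::chilbert_space \<Rightarrow> 'a"
  assumes S: "positive_op S" "S \<circ> S = A"
    and comm: "\<And>D x. bounded_linear D \<Longrightarrow> (\<And>x. D (A x) = A (D x)) \<Longrightarrow> D (S x) = S (D x)"
  shows "sqrt_op A = S"
  unfolding sqrt_op_def
proof (rule the_equality)
  fix R
  assume R: "positive_op R \<and> R \<circ> R = A"
  then have A: "R (R x) = A x" "S (S x) = A x" for x
    using S by (auto simp: fun_eq_iff)
  have S_lin: "linear S"
    using S by (auto simp: positive_op_def bounded_clinear_def bounded_linear.linear)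
  have "bounded_linear R"
    using R by (auto simp: positive_op_def bounded_clinear_def)
  then have RS: "R (S x) = S (R x)" for x
    by (rule comm) (simp flip: A(1))
  have "R x = S x" for x
    by (rule square_root_unique_on[of R S UNIV])
      (use R S_lin RS A positive_op_selfadjoint[OF S(1)] positive_op_inner[OF S(1)] in simp_all)
  then show "R = S"
    by blast
qed (use S in blast)

lemma
  fixes A :: "'a::chilbert_space \<Rightarrow> 'a"
  assumes "positive_op A"
  shows positive_op_sqrt_op: "positive_op (sqrt_op A)"
    and sqrt_op_square: "sqrt_op A (sqrt_op A x) = A x"
    and sqrt_op_commute:
      "bounded_linear D \<Longrightarrow> (\<And>x. D (A x) = A (D x)) \<Longrightarrow> D (sqrt_op A x) = sqrt_op A (D x)"
    and sqrt_op_invariant: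
      "subspace M \<Longrightarrow> closed M \<Longrightarrow> A ` M \<subseteq> M \<Longrightarrow> sqrt_op A ` M \<subseteq> M"
proof -
  obtain S where S: "positive_op S" "S \<circ> S = A"
    and comm: "\<And>D x. bounded_linear D \<Longrightarrow> (\<And>x. D (A x) = A (D x)) \<Longrightarrow> D (S x) = S (D x)"
    and inv: "\<And>M. subspace M \<Longrightarrow> closed M \<Longrightarrow> A ` M \<subseteq> M \<Longrightarrow> S ` M \<subseteq> M"
    using positive_square_root_exists[OF assms] by metis
  have eq: "sqrt_op A = S"
    using S comm by (rule sqrt_op_equality)
  show "positive_op (sqrt_op A)" "sqrt_op A (sqrt_op A x) = A x"
    using S by (auto simp: eq fun_eq_iff)
  show "D (sqrt_op A x) = sqrt_op A (D x)" if "bounded_linear D" "\<And>x. D (A x) = A (D x)"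
    unfolding eq using that by (rule comm)
  show "sqrt_op A ` M \<subseteq> M" if "subspace M" "closed M" "A ` M \<subseteq> M"
    unfolding eq using that by (rule inv)
qed

section \<open>Reducing subspaces of a normal operator and of its absolute value\<close>

lemma bounded_clinear_compose:
  "bounded_clinear S \<Longrightarrow> bounded_clinear T \<Longrightarrow> bounded_clinear (\<lambda>x. S (T x))"
  by (simp add: bounded_clinear_def bounded_linear_compose)

lemma positive_op_cadjoint_compose:
  assumes "bounded_clinear T"
  shows "positive_op (cadjoint T \<circ> T)"
proof (rule positive_opI)
  show "bounded_clinear (cadjoint T \<circ> T)"
    unfolding comp_def
    by (rule bounded_clinear_compose[OF bounded_clinear_cadjoint[OF assms] assms])
  have "inner (cadjoint T (T x)) y = inner (T x) (T y)" for x y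
    using inner_cadjoint[OF assms, of y "T x"] by (simp add: inner_commute)
  then show "inner ((cadjoint T \<circ> T) x) y = inner x ((cadjoint T \<circ> T) y)"
    "0 \<le> inner ((cadjoint T \<circ> T) x) x" for x y
    using inner_cadjoint[OF assms, of x "T y"] by simp_all
qed

lemma cadjoint_positive_op:
  assumes "positive_op A"
  shows "cadjoint A = A"
proof (rule cadjoint_equality)
  show A: "bounded_clinear A"
    using assms by (simp add: positive_op_def)
  then show "cinner (A x) y = cinner x (A y)" for x y
    by (intro cinner_adjointI positive_op_selfadjoint assms) (simp_all add: bounded_clinear_def)
qed

lemma
  assumes "bounded_clinear T"
  shows positive_op_abs_op: "positive_op (abs_op T)"
    and abs_op_square: "abs_op T (abs_op T x) = cadjoint T (T x)"
    and norm_abs_op: "norm (abs_op T x) = norm (T x)"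
proof -
  note pos = positive_op_cadjoint_compose[OF assms]
  show A: "positive_op (abs_op T)"
    unfolding abs_op_def using pos by (rule positive_op_sqrt_op)
  show sq: "abs_op T (abs_op T x) = cadjoint T (T x)" for x
    unfolding abs_op_def by (simp add: sqrt_op_square[OF pos])
  show "norm (abs_op T x) = norm (T x)"
    by (simp add: norm_eq_sqrt_inner positive_op_selfadjoint[OF A] inner_cadjoint[OF assms] sq)
qed

lemma min_attaining_on_cong:
  assumes "\<And>x. norm (A x) = norm (B x)"
  shows "min_attaining_on M A \<longleftrightarrow> min_attaining_on M B"
  unfolding min_attaining_on_def min_modulus_on_def by (simp add: assms)

lemma reduces_imp_reduces_abs_op:
  assumes T: "bounded_clinear T" and M: "reduces M T"
  shows "reduces M (abs_op T)"
proof -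
  have "abs_op T ` M \<subseteq> M"
    unfolding abs_op_def
    using M by (intro sqrt_op_invariant positive_op_cadjoint_compose[OF T])
      (auto simp: reduces_def csubspace_imp_subspace)
  with M show ?thesis
    by (simp add: reduces_def cadjoint_positive_op[OF positive_op_abs_op[OF T]])
qed

section \<open>Minimum modulus on a subspace\<close>

lemma unit_vector_exists:
  assumes "complex_vector.subspace M" "M \<noteq> {0}"
  obtains x where "x \<in> M" "norm (x::'a::complex_inner) = 1"
proof -
  have M: "subspace M"
    using assms(1) by (rule csubspace_imp_subspace)
  then obtain y where y: "y \<in> M" "y \<noteq> 0"
    using assms(2) subspace_0[OF M] by blast
  show thesis
    using that[of "sgn y"] y subspace_scale[OF M y(1)] by (simp add: sgn_div_norm norm_sgn)
qed

lemma bdd_below_norms: "bdd_below {norm (A x) | x. x \<in> M \<and> norm x = 1}"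
  by (rule bdd_belowI[where m = 0]) auto

lemma min_modulus_on_le:
  "x \<in> M \<Longrightarrow> norm x = 1 \<Longrightarrow> min_modulus_on M A \<le> norm (A x)"
  unfolding min_modulus_on_def by (rule cInf_lower[OF _ bdd_below_norms]) blast

lemma min_modulus_on_greatest:
  assumes "complex_vector.subspace M" "M \<noteq> {0}"
    and "\<And>x. x \<in> M \<Longrightarrow> norm x = 1 \<Longrightarrow> c \<le> norm (A x)"
  shows "c \<le> min_modulus_on M A"
  unfolding min_modulus_on_def
proof (rule cInf_greatest)
  show "{norm (A x) |x. x \<in> M \<and> norm x = 1} \<noteq> {}"
    using unit_vector_exists[OF assms(1,2)] by blast
qed (use assms(3) in auto)

lemma min_modulus_on_norm_le:
  assumes "subspace M" "linear A" "x \<in> M"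
  shows "min_modulus_on M A * norm x \<le> norm (A x)"
proof (cases "x = 0")
  case False
  have "min_modulus_on M A \<le> norm (A ((1 / norm x) *\<^sub>R x))"
    using False assms by (intro min_modulus_on_le subspace_scale) auto
  then show ?thesis
    using False assms(2) by (simp add: linear_scale field_simps)
qed (use linear_0[OF assms(2)] in simp)

text \<open>A reducing subspace \<open>M\<close> of \<open>|T|\<close> need not reduce \<open>T\<close>.  With \<open>m\<close> the minimum modulus on \<open>M\<close>,
  \<open>C = T\<^sup>*T - m\<^sup>2\<close> and \<open>R = |C|\<close>, we have \<open>R = C\<close> on \<open>M\<close>.  If \<open>M\<close> did not meet \<open>ker C\<close>, it would
  be orthogonal to it, so that \<open>M\<close> would lie in \<open>L = ker (R - C) \<inter> (ker C)\<^sup>\<bottom>\<close>, which does reduce \<open>T\<close>.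
  The minimum modulus of \<open>T\<close> on \<open>L\<close> is again \<open>m\<close>, and a vector attaining it lies in \<open>ker C\<close>.\<close>

lemma min_attaining_on_reducing_abs_op:
  fixes T :: "'a::chilbert_space \<Rightarrow> 'a"
  assumes normal: "normal_op T"
    and attains: "\<And>L. reduces L T \<Longrightarrow> L \<noteq> {0} \<Longrightarrow> min_attaining_on L T"
    and M: "reduces M (abs_op T)" "M \<noteq> {0}"
  shows "min_attaining_on M T"
proof -
  have T: "bounded_clinear T"
    using normal by (simp add: normal_op_def)
  define T' where "T' = cadjoint T"
  define A where "A = abs_op T"
  define B where "B x = T' (T x)" for x
  define m where "m = min_modulus_on M T"
  \<comment> \<open>The form of \<open>C\<close> at \<open>x\<close> is | T x |^2 - m^2 | x |^2, so
    its sign compares | T x | with m | x |.\<close>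
  define C where "C x = B x - (m\<^sup>2) *\<^sub>R x" for x
  define R where "R = sqrt_op (C \<circ> C)"
  have T': "bounded_clinear T'"
    unfolding T'_def by (rule bounded_clinear_cadjoint[OF T])
  have adj: "inner (T x) y = inner x (T' y)" "inner (T' x) y = inner x (T y)" for x y
    using inner_cadjoint[OF T, of x y] inner_cadjoint[OF T, of y x]
    by (simp_all add: T'_def inner_commute)
  interpret T: bounded_linear T
    using T by (simp add: bounded_clinear_def)
  interpret T': bounded_linear T'
    using T' by (simp add: bounded_clinear_def)
  have scaleC: "T (c *\<^sub>C x) = c *\<^sub>C T x" "T' (c *\<^sub>C x) = c *\<^sub>C T' x" for c x
    using T T' by (simp_all add: bounded_clinear_def)
  \<comment> \<open>Normality enters here: it makes \<open>T\<close> and \<open>T'\<close> commute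
    with \<open>C\<close>, and therefore with \<open>R\<close>.\<close>
  have TT': "T' (T x) = T (T' x)" for x
    using normal unfolding normal_op_def T'_def by (metis comp_apply)
  have bl_B: "bounded_linear B"
    unfolding B_def by (rule bounded_linear_compose[OF T'.bounded_linear_axioms T.bounded_linear_axioms])
  have bl_C: "bounded_linear C"
    unfolding C_def
    by (intro bounded_linear_sub bounded_linear_const_scaleR bounded_linear_ident bl_B)
  interpret B: bounded_linear B
    by (rule bl_B)
  interpret C: bounded_linear C
    by (rule bl_C)
  have scaleC_B: "B (c *\<^sub>C x) = c *\<^sub>C B x" for c x
    by (simp add: B_def scaleC)
  have scaleC_C: "C (c *\<^sub>C x) = c *\<^sub>C C x" for c x
    unfolding C_def scaleC_B complex_vector.scale_right_diff_distrib
    by (simp flip: scaleC_of_real add: scaleC_scaleC mult.commute)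
  have saB: "inner (B x) y = inner x (B y)" for x y
    by (simp add: B_def adj)
  have saC: "inner (C x) y = inner x (C y)" for x y
    by (simp add: C_def saB inner_diff)
  have inner_C: "inner (C x) x = (norm (T x))\<^sup>2 - m\<^sup>2 * (norm x)\<^sup>2" for x
    by (simp add: C_def B_def inner_diff adj power2_norm_eq_inner)
  have T_C: "T (C x) = C (T x)" "T' (C x) = C (T' x)" for x
    by (simp_all add: C_def B_def T.diff T.scaleR T'.diff T'.scaleR TT')

  have CC: "positive_op (C \<circ> C)"
  proof (rule positive_opI)
    show "bounded_clinear (C \<circ> C)"
      by (simp add: bounded_clinear_def comp_def scaleC_C bounded_linear_compose[OF bl_C bl_C])
    show "0 \<le> inner ((C \<circ> C) x) x" for x
      using inner_ge_zero[of "C x"] by (simp add: saC)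
  qed (simp add: saC)
  have R: "positive_op R"
    unfolding R_def by (rule positive_op_sqrt_op[OF CC])
  have RR: "R (R x) = C (C x)" for x
    unfolding R_def by (simp add: sqrt_op_square[OF CC])
  have R_comm: "D (R x) = R (D x)" if "bounded_linear D" "\<And>x. D (C x) = C (D x)" for D x
    unfolding R_def by (rule sqrt_op_commute[OF CC]) (simp_all add: that)
  interpret R: bounded_linear R
    using R by (simp add: positive_op_def bounded_clinear_def)
  have scaleC_R: "R (c *\<^sub>C x) = c *\<^sub>C R x" for c x
    using R by (simp add: positive_op_def bounded_clinear_def)
  have T_R: "T (R x) = R (T x)" "T' (R x) = R (T' x)" for x
    by (intro R_comm T.bounded_linear_axioms T'.bounded_linear_axioms T_C)+

  have csub: "complex_vector.subspace M" and clM: "closed M" and AM: "A ` M \<subseteq> M"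
    using M by (auto simp: reduces_def A_def)
  have subM: "subspace M"
    using csub by (rule csubspace_imp_subspace)
  \<comment> \<open>\<open>M\<close> may fail to be invariant under \<open>T\<close>, but
    \<open>B\<close> is the square of \<open>abs_op T\<close>.\<close>
  have BM: "B x \<in> M" if "x \<in> M" for x
    using AM that unfolding A_def B_def T'_def abs_op_square[OF T, symmetric] by blast
  then have CM: "C ` M \<subseteq> M"
    using subM unfolding C_def by (auto intro!: subspace_diff subspace_scale)
  have m_nonneg: "0 \<le> m"
    unfolding m_def by (rule min_modulus_on_greatest[OF csub M(2)]) simp
  have m_le: "m * norm x \<le> norm (T x)" if "x \<in> M" for x
    unfolding m_def by (rule min_modulus_on_norm_le[OF subM T.linear_axioms that])
  have C_pos: "0 \<le> inner (C x) x" if "x \<in> M" for x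
    using power_mono[OF m_le[OF that], of 2] m_nonneg by (simp add: inner_C power_mult_distrib)
  have R_eq_C: "R x = C x" if "x \<in> M" for x
  proof (rule square_root_unique_on[OF R C.linear_axioms saC _ RR subM _ CM C_pos that])
    show "R (C x) = C (R x)" for x
      by (rule R_comm[OF bl_C, symmetric]) simp
    have "(C \<circ> C) ` M \<subseteq> M"
      using CM by auto
    then show "R ` M \<subseteq> M"
      unfolding R_def by (rule sqrt_op_invariant[OF CC subM clM])
  qed

  have "\<exists>x\<in>M. C x = 0 \<and> x \<noteq> 0"
  proof (rule ccontr)
    assume disjoint: "\<not> (\<exists>x\<in>M. C x = 0 \<and> x \<noteq> 0)"
    \<comment> \<open>On this subspace \<open>C\<close> is positive and injective. The real inner
      product defines the same orthogonal complement as the complex one, as the kernel of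
      \<open>C\<close> is a complex subspace.\<close>
    define L where "L = {z. R z = C z \<and> (\<forall>e. C e = 0 \<longrightarrow> inner z e = 0)}"
    have "M \<subseteq> L"
    proof
      fix x
      assume x: "x \<in> M"
      have "inner x e = 0" if e: "C e = 0" for e
      proof -
        \<comment> \<open>The projection \<open>p\<close> of \<open>e\<close> onto \<open>M\<close>
          again lies in the kernel of \<open>C\<close>, so it is 0 and \<open>e\<close> is
          orthogonal to \<open>M\<close>.\<close>
        obtain p where p: "p \<in> M" "\<And>w. w \<in> M \<Longrightarrow> inner (e - p) w = 0"
          by (rule closed_subspace_decomposition[OF subM clM, of e]) blast
        have CpM: "C p \<in> M"
          using CM p(1) by blast
        have "inner (C p) (C p) = inner p (C (C p))"
          by (rule saC)
        also have "\<dots> = inner e (C (C p))"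
          using p(2)[of "C (C p)"] CM CpM by (auto simp: inner_diff)
        also have "\<dots> = 0"
          by (simp add: saC[symmetric] e)
        finally have "p = 0"
          using disjoint p(1) by auto
        with p(2)[OF x] show ?thesis
          by (simp add: inner_commute)
      qed
      with R_eq_C[OF x] show "x \<in> L"
        by (simp add: L_def)
    qed
    have csubL: "complex_vector.subspace L"
      by (rule complex_vector.subspaceI)
        (auto simp: L_def R.zero C.zero R.add C.add scaleC_R scaleC_C inner_add inner_scaleC_left)
    have "closed L"
      unfolding L_def
      by (intro closed_Collect_conj closed_Collect_all closed_Collect_imp closed_Collect_eq
          open_Collect_const continuous_intros R.continuous_on C.continuous_on)
    \<comment> \<open>Both operators commute with \<open>R\<close> and \<open>C\<close>; moving one
      across the inner product gives its adjoint, which preserves the kernel of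
      \<open>C\<close>.\<close>
    moreover have "T ` L \<subseteq> L" "T' ` L \<subseteq> L"
      by (auto simp: L_def adj T_R[symmetric] T_C[symmetric])
    ultimately have "reduces L T"
      using csubL by (simp add: reduces_def T'_def)
    moreover have "L \<noteq> {0}"
      using \<open>M \<subseteq> L\<close> M(2) subspace_0[OF subM] by blast
    ultimately obtain y where y: "y \<in> L" "norm y = 1" "norm (T y) = min_modulus_on L T"
      using attains unfolding min_attaining_on_def by blast
    have "min_modulus_on L T \<le> m"
      unfolding m_def using \<open>M \<subseteq> L\<close>
      by (intro min_modulus_on_greatest[OF csub M(2)] min_modulus_on_le) auto
    then have "(norm (T y))\<^sup>2 \<le> m\<^sup>2"
      unfolding y(3)[symmetric] by (rule power_mono) simp
    then have "inner (C y) y \<le> 0"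
      by (simp add: inner_C y(2))
    moreover have Ry: "R y = C y"
      using y(1) by (simp add: L_def)
    ultimately have "inner (R y) y = 0"
      using positive_op_inner[OF R, of y] by simp
    from positive_op_eq_0[OF R this] have "C y = 0"
      by (simp add: Ry)
    \<comment> \<open>\<open>y\<close> lies in the kernel of \<open>C\<close> and is orthogonal to
      it.\<close>
    then have "inner y y = 0"
      using y(1) by (simp add: L_def)
    then show False
      using y(2) by simp
  qed
  then obtain x where x: "x \<in> M" "C x = 0" "x \<noteq> 0"
    by blast
  define u where "u = (1 / norm x) *\<^sub>R x"
  have u: "u \<in> M" "norm u = 1" "C u = 0"
    using x subM by (simp_all add: u_def subspace_scale C.scaleR)
  then have "(norm (T u))\<^sup>2 = m\<^sup>2"
    using inner_C[of u] by simp
  then have "norm (T u) = m"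
    using m_nonneg by simp
  with u show ?thesis
    unfolding min_attaining_on_def m_def by blast
qed

theorem corollary6p3:
  fixes T :: "'a::chilbert_space \<Rightarrow> 'a"
  assumes "infinite_cdimensional TYPE('a)"
    and "separable_space (euclidean :: 'a topology)"
    and "normal_op T"
  shows "T \<in> \<M>\<^sub>r \<longleftrightarrow> abs_op T \<in> \<M>\<^sub>r"
proof -
  have T: "bounded_clinear T"
    using assms(3) by (simp add: normal_op_def)
  have abs_op: "bounded_clinear (abs_op T)"
    using positive_op_abs_op[OF T] by (simp add: positive_op_def)
  have attains_iff: "min_attaining_on M (abs_op T) \<longleftrightarrow> min_attaining_on M T" for M
    by (rule min_attaining_on_cong) (rule norm_abs_op[OF T])
  show ?thesis
  proof
    assume "T \<in> \<M>\<^sub>r"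
    then have "min_attaining_on L T" if "reduces L T" "L \<noteq> {0}" for L
      using that by (simp add: reducing_min_attaining_def)
    then have "min_attaining_on M T" if "reduces M (abs_op T)" "M \<noteq> {0}" for M
      using assms(3) that by (intro min_attaining_on_reducing_abs_op[of T M])
    then show "abs_op T \<in> \<M>\<^sub>r"
      by (simp add: reducing_min_attaining_def abs_op attains_iff)
  next
    assume "abs_op T \<in> \<M>\<^sub>r"
    then show "T \<in> \<M>\<^sub>r"
      using reduces_imp_reduces_abs_op[OF T]
      by (simp add: reducing_min_attaining_def T attains_iff)
  qed
qed

end
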